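(* Let $(\gamma_t,f_1,f_2):I\to AdS^3\times\Delta_5$ be a pseudo-spherical timelike framed immersion with curvature $(\alpha,\hat\ell,0,\hat n)$, with $\hat n^2>\alpha^2$ and $f<0$ on $I$, and let $\mathcal{E}_a(\gamma_t)$ be its AdS-evolute (taken with the $+$ sign). Then $\mathcal{E}_a(\gamma_t)$ is a pseudo-spherical spacelike framed base curve in $AdS^3$. More precisely, put $W=\alpha\hat n'-\hat n\alpha'$ and $$\eta=\frac{\alpha\gamma_t-\hat nf_2}{\sqrt{\hat n^2-\alpha^2}},\qquad \mu_{\mathcal{E}_a}=\frac{W(\hat n\gamma_t-\alpha f_2)-\hat\ell\hat n(\hat n^2-\alpha^2)f_1}{\sqrt{\hat n^2-\alpha^2}\,\sqrt{\hat\ell^2\hat n^2(\hat n^2-\alpha^2)-W^2}} .$$ Then $(\mathcal{E}_a(\gamma_t),\mu,\eta)$ is a pseudo-spherical spacelike framed immersion with $\mu_{\mathcal{E}_a}=\mathcal{E}_a(\gamma_t)\times\mu\times\eta$ and curvature $(\alpha_{\mathcal{E}_a},\hat\ell_{\mathcal{E}_a},0,\hat n_{\mathcal{E}_a})$, where $$\alpha_{\mathcal{E}_a}=\sqrt{\hat n^2-\alpha^2}\;\frac{\hat n\big(2\hat\ell\alpha'\hat n'-\hat n(-\alpha'\hat\ell'+\hat\ell\alpha'')\big)-\alpha\big(\hat\ell^3\hat n^2+\hat n\hat\ell'\hat n'+\hat\ell(2(\hat n')^2-\hat n\hat n'')\big)}{\hat\ell^2\hat n^2(\hat n^2-\alpha^2)-W^2},$$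 $$\hat\ell_{\mathcal{E}_a}=-\sqrt{\hat n^2-\alpha^2},\qquad \hat n_{\mathcal{E}_a}=\frac{\sqrt{\hat\ell^2\hat n^2(\hat n^2-\alpha^2)-W^2}}{\alpha^2-\hat n^2} .$$
   Context: $\mathbb{R}^4_2$ is $\mathbb{R}^4$ with $\langle u,w\rangle=-u_1w_1-u_2w_2+u_3w_3+u_4w_4$; the triple product $u\times v\times w$ is the unique vector with $\langle x,u\times v\times w\rangle=\det(x,u,v,w)$ for all $x$. $AdS^3=\{u:\langle u,u\rangle=-1\}$, $S^3_2=\{u:\langle u,u\rangle=1\}$; $\Delta_1=\{(u,w):\langle u,w\rangle=0\}\subset AdS^3\times S^3_2$ (or $\subset S^3_2\times AdS^3$); $\Delta_5=\{(u,w)\in S^3_2\times S^3_2:\langle u,w\rangle=0\}$. A pseudo-spherical spacelike (resp. timelike) framed immersion is a smooth immersion $(\gamma,v_1,v_2):I\to AdS^3\times\Delta_1$ (resp. $AdS^3\times\Delta_5$) with $\langle\gamma,v_i\rangle=\langle\gamma',v_i\rangle=0$, $i=1,2$; $\gamma$ is then called a framed base curve. With $\nu=\gamma\times v_1\times v_2$, its curvature $(\alpha,\ell,m,n)$ is defined by $\gamma'=\alpha\nu$, $v_1'=\ell v_2+m\nu$, and $v_2'=\ell v_1+n\nu$ (spacelike case) or $v_2'=-\ell v_1+n\nu$ (timelike case). For the given $(\gamma_t,f_1,f_2)$ with curvature $(\alpha,\hat\ell,0,\hat n)$ and $\mu=\gamma_t\times f_1\times f_2$ (unit timelike) this means $$\gamma_t'=\alpha\mu,\quad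 f_1'=\hat\ell f_2,\quad f_2'=-\hat\ell f_1+\hat n\mu,\quad \mu'=-\alpha\gamma_t+\hat nf_2 .$$ Put $f=(\alpha\hat n'-\hat n\alpha')^2-\hat\ell^2\hat n^2(\hat n^2-\alpha^2)$. The total evolute is $$\mathcal{E}(\gamma_t)=\pm\frac{\hat\ell\hat n(\hat n\gamma_t-\alpha f_2)-(\alpha\hat n'-\hat n\alpha')f_1}{\sqrt{|f|}} ;$$ when $f<0$ (which requires $\hat n^2>\alpha^2$) it lies in $AdS^3$, is denoted $\mathcal{E}_a(\gamma_t)$, and is called the AdS-evolute. *)

theory Defs
  imports "HOL-Analysis.Analysis"
begin

subsection \<open>Smooth curves on an interval\<close>

text \<open>Derivatives are taken within the parameter interval: two-sided at interior points, and
  one-sided at an end point that belongs to the interval. The values of a curve outside its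
  interval play no role.\<close>

definition deriv_on :: "real set \<Rightarrow> (real \<Rightarrow> 'a::real_normed_vector) \<Rightarrow> real \<Rightarrow> 'a" where
  "deriv_on I g t = vector_derivative g (at t within I)"

definition smooth_curve_on :: "real set \<Rightarrow> (real \<Rightarrow> 'a::real_normed_vector) \<Rightarrow> bool" where
  "smooth_curve_on I g \<longleftrightarrow>
     (\<forall>k. \<forall>t\<in>I. ((deriv_on I ^^ k) g) differentiable (at t within I))"

text \<open>A curve is an immersion iff its velocity vanishes nowhere. A curve in an embedded submanifold
  is smooth (an immersion) iff it is so as a curve in the ambient vector space.\<close>

definition smooth_immersion_on :: "real set \<Rightarrow> (real \<Rightarrow> 'a::real_normed_vector) \<Rightarrow> bool" where
  "smooth_immersion_on I g \<longleftrightarrow> smooth_curve_on I g \<and> (\<forall>t\<in>I. deriv_on I g t \<noteq> 0)"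

subsection \<open>The pseudo-Euclidean space of index 2\<close>

definition pip :: "real^4 \<Rightarrow> real^4 \<Rightarrow> real" where
  "pip u w = - u$1 * w$1 - u$2 * w$2 + u$3 * w$3 + u$4 * w$4"

definition triple :: "real^4 \<Rightarrow> real^4 \<Rightarrow> real^4 \<Rightarrow> real^4" where
  "triple u v w = (THE p. \<forall>x. pip x p = det (vector [x, u, v, w] :: real^4^4))"

lemma vector_4_nth:
  "(vector [a, b, c, d] :: 'a::zero^4) $ 1 = a"
  "(vector [a, b, c, d] :: 'a::zero^4) $ 2 = b"
  "(vector [a, b, c, d] :: 'a::zero^4) $ 3 = c"
  "(vector [a, b, c, d] :: 'a::zero^4) $ 4 = d"
  by (simp_all add: vector_def)

lemma pip_right_unique:
  assumes "\<And>x. pip x p = pip x q"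
  shows "p = q"
proof -
  have "p $ i = q $ i" for i
    using assms[of "axis i 1"] exhaust_4[of i] by (auto simp: pip_def axis_def)
  then show ?thesis
    by (simp add: vec_eq_iff)
qed

lemma pip_triple: "pip x (triple u v w) = det (vector [x, u, v, w] :: real^4^4)"
proof -
  let ?D = "\<lambda>x. det (vector [x, u, v, w] :: real^4^4)"
  have D: "?D x = det (\<chi> i. if i = 1 then x else (vector [0, u, v, w] :: real^4^4) $ i)" for x
    by (rule arg_cong[where f = det]) (simp add: vec_eq_iff forall_4 vector_4_nth)
  have add: "?D (x + y) = ?D x + ?D y" for x y
    unfolding D by (rule det_row_add)
  have scale: "?D (c *s x) = c * ?D x" for c x
    unfolding D by (rule det_row_mul)
  define p :: "real^4" where
    "p = vector [- ?D (axis 1 1), - ?D (axis 2 1), ?D (axis 3 1), ?D (axis 4 1)]"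
  have p: "pip x p = ?D x" for x
  proof -
    have "x = x$1 *s axis 1 1 + x$2 *s axis 2 1 + x$3 *s axis 3 1 + x$4 *s axis 4 1"
      by (simp add: vec_eq_iff forall_4 axis_def)
    then have "?D x = ?D (x$1 *s axis 1 1 + x$2 *s axis 2 1 + x$3 *s axis 3 1 + x$4 *s axis 4 1)"
      by simp
    also have "\<dots> = x$1 * ?D (axis 1 1) + x$2 * ?D (axis 2 1) + x$3 * ?D (axis 3 1) + x$4 * ?D (axis 4 1)"
      by (simp only: add scale)
    finally show ?thesis
      by (simp add: pip_def p_def vector_4_nth)
  qed
  have "triple u v w = p"
    unfolding triple_def
  proof (rule the_equality)
    show "\<forall>x. pip x p = ?D x" using p by blast
    show "q = p" if "\<forall>x. pip x q = ?D x" for q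
      using that p by (intro pip_right_unique) simp
  qed
  with p show ?thesis by simp
qed

definition AdS3 :: "(real^4) set" where
  "AdS3 = {u. pip u u = -1}"

definition S32 :: "(real^4) set" where
  "S32 = {u. pip u u = 1}"

text \<open>Either one of the two orthogonal unit vectors may be the timelike one.\<close>

definition Delta1 :: "((real^4) \<times> (real^4)) set" where
  "Delta1 = {(u, w). pip u w = 0 \<and> (u, w) \<in> AdS3 \<times> S32 \<union> S32 \<times> AdS3}"

definition Delta5 :: "((real^4) \<times> (real^4)) set" where
  "Delta5 = {(u, w). pip u w = 0 \<and> (u, w) \<in> S32 \<times> S32}"

subsection \<open>Framed immersions\<close>

definition framed_immersion ::
  "((real^4) \<times> (real^4)) set \<Rightarrow> real set \<Rightarrow> (real \<Rightarrow> real^4) \<Rightarrow> (real \<Rightarrow> real^4) \<Rightarrow> (real \<Rightarrow> real^4) \<Rightarrow> bool"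
  where
  "framed_immersion D I \<gamma> v1 v2 \<longleftrightarrow>
     smooth_immersion_on I (\<lambda>t. (\<gamma> t, v1 t, v2 t)) \<and>
     (\<forall>t\<in>I. \<gamma> t \<in> AdS3 \<and> (v1 t, v2 t) \<in> D \<and>
        pip (\<gamma> t) (v1 t) = 0 \<and> pip (\<gamma> t) (v2 t) = 0 \<and>
        pip (deriv_on I \<gamma> t) (v1 t) = 0 \<and> pip (deriv_on I \<gamma> t) (v2 t) = 0)"

definition spacelike_framed_immersion ::
  "real set \<Rightarrow> (real \<Rightarrow> real^4) \<Rightarrow> (real \<Rightarrow> real^4) \<Rightarrow> (real \<Rightarrow> real^4) \<Rightarrow> bool" where
  "spacelike_framed_immersion = framed_immersion Delta1"

definition timelike_framed_immersion ::
  "real set \<Rightarrow> (real \<Rightarrow> real^4) \<Rightarrow> (real \<Rightarrow> real^4) \<Rightarrow> (real \<Rightarrow> real^4) \<Rightarrow> bool" where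
  "timelike_framed_immersion = framed_immersion Delta5"

definition spacelike_framed_base_curve :: "real set \<Rightarrow> (real \<Rightarrow> real^4) \<Rightarrow> bool" where
  "spacelike_framed_base_curve I \<gamma> \<longleftrightarrow> (\<exists>v1 v2. spacelike_framed_immersion I \<gamma> v1 v2)"

text \<open>The sign in front of \<open>l\<close> in the equation of the second frame vector is the only difference
  between the two cases.\<close>

definition spacelike_curvature ::
  "real set \<Rightarrow> (real \<Rightarrow> real^4) \<Rightarrow> (real \<Rightarrow> real^4) \<Rightarrow> (real \<Rightarrow> real^4) \<Rightarrow>
   (real \<Rightarrow> real) \<Rightarrow> (real \<Rightarrow> real) \<Rightarrow> (real \<Rightarrow> real) \<Rightarrow> (real \<Rightarrow> real) \<Rightarrow> bool" where
  "spacelike_curvature I \<gamma> v1 v2 \<alpha> l m n \<longleftrightarrow>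
     (\<forall>t\<in>I. let \<nu> = triple (\<gamma> t) (v1 t) (v2 t) in
        deriv_on I \<gamma> t = \<alpha> t *\<^sub>R \<nu> \<and>
        deriv_on I v1 t = l t *\<^sub>R v2 t + m t *\<^sub>R \<nu> \<and>
        deriv_on I v2 t = l t *\<^sub>R v1 t + n t *\<^sub>R \<nu>)"

definition timelike_curvature ::
  "real set \<Rightarrow> (real \<Rightarrow> real^4) \<Rightarrow> (real \<Rightarrow> real^4) \<Rightarrow> (real \<Rightarrow> real^4) \<Rightarrow>
   (real \<Rightarrow> real) \<Rightarrow> (real \<Rightarrow> real) \<Rightarrow> (real \<Rightarrow> real) \<Rightarrow> (real \<Rightarrow> real) \<Rightarrow> bool" where
  "timelike_curvature I \<gamma> v1 v2 \<alpha> l m n \<longleftrightarrow>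
     (\<forall>t\<in>I. let \<nu> = triple (\<gamma> t) (v1 t) (v2 t) in
        deriv_on I \<gamma> t = \<alpha> t *\<^sub>R \<nu> \<and>
        deriv_on I v1 t = l t *\<^sub>R v2 t + m t *\<^sub>R \<nu> \<and>
        deriv_on I v2 t = - l t *\<^sub>R v1 t + n t *\<^sub>R \<nu>)"

subsection \<open>Evolutes\<close>

text \<open>The framed curve \<open>(\<gamma>, f1, f2)\<close> is timelike, with curvature \<open>(\<alpha>, l, 0, n)\<close>.\<close>

definition evolute_disc ::
  "real set \<Rightarrow> (real \<Rightarrow> real) \<Rightarrow> (real \<Rightarrow> real) \<Rightarrow> (real \<Rightarrow> real) \<Rightarrow> real \<Rightarrow> real" where
  "evolute_disc I \<alpha> l n t =
     (\<alpha> t * deriv_on I n t - n t * deriv_on I \<alpha> t)\<^sup>2 - (l t)\<^sup>2 * (n t)\<^sup>2 * ((n t)\<^sup>2 - (\<alpha> t)\<^sup>2)"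

text \<open>The choice of sign in the total evolute is the argument \<open>s\<close>, either \<open>1\<close> or \<open>-1\<close>.\<close>

definition total_evolute ::
  "real \<Rightarrow> real set \<Rightarrow> (real \<Rightarrow> real^4) \<Rightarrow> (real \<Rightarrow> real^4) \<Rightarrow> (real \<Rightarrow> real^4) \<Rightarrow>
   (real \<Rightarrow> real) \<Rightarrow> (real \<Rightarrow> real) \<Rightarrow> (real \<Rightarrow> real) \<Rightarrow> real \<Rightarrow> real^4" where
  "total_evolute s I \<gamma> f1 f2 \<alpha> l n t =
     s *\<^sub>R (((l t * n t) *\<^sub>R (n t *\<^sub>R \<gamma> t - \<alpha> t *\<^sub>R f2 t)
            - (\<alpha> t * deriv_on I n t - n t * deriv_on I \<alpha> t) *\<^sub>R f1 t)
           /\<^sub>R sqrt \<bar>evolute_disc I \<alpha> l n t\<bar>)"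

text \<open>The AdS-evolute is the name of the total evolute in the case of negative \<^const>\<open>evolute_disc\<close>;
  here it carries the plus sign.\<close>

definition AdS_evolute ::
  "real set \<Rightarrow> (real \<Rightarrow> real^4) \<Rightarrow> (real \<Rightarrow> real^4) \<Rightarrow> (real \<Rightarrow> real^4) \<Rightarrow>
   (real \<Rightarrow> real) \<Rightarrow> (real \<Rightarrow> real) \<Rightarrow> (real \<Rightarrow> real) \<Rightarrow> real \<Rightarrow> real^4" where
  "AdS_evolute = total_evolute 1"

end

theory Submission
  imports Defs
begin

text \<open>The triple product \<open>\<mu> = \<gamma> \<times> f1 \<times> f2\<close> satisfies \<open>\<mu>' = - \<alpha> \<gamma> + n f2\<close>, so \<open>\<mu>'\<close> is a multiple of \<open>\<eta>\<close>,
  and \<open>E\<close> is a unit vector orthogonal to \<open>\<mu>\<close>, \<open>\<mu>'\<close> and \<open>\<mu>''\<close>. Hence \<open>\<eta>'\<close> has no component along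
  \<open>E\<close>, and \<open>E'\<close> is a multiple of \<open>E \<times> \<mu> \<times> \<eta>\<close>. The multiples come from comparing coefficients in the
  frame \<open>\<gamma>, f1, f2, \<mu>\<close>, whose triple products all follow from the rule for \<open>(u \<times> v \<times> w) \<times> v \<times> w\<close>.\<close>

subsection \<open>Smoothness on an interval\<close>

text \<open>\<open>ndiff_on k I g\<close> asks for \<open>k + 1\<close> derivatives. A recursion that peels off the innermost
  derivative turns closure under an operation into an induction on \<open>k\<close>, for which its product or
  chain rule is enough.\<close>

primrec ndiff_on :: "nat \<Rightarrow> real set \<Rightarrow> (real \<Rightarrow> 'a::real_normed_vector) \<Rightarrow> bool" where
  "ndiff_on 0 I g \<longleftrightarrow> (\<forall>t\<in>I. g differentiable (at t within I))"
| "ndiff_on (Suc k) I g \<longleftrightarrow>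
     (\<forall>t\<in>I. g differentiable (at t within I)) \<and> ndiff_on k I (deriv_on I g)"

lemma ndiff_on_iff:
  "ndiff_on k I g \<longleftrightarrow> (\<forall>j\<le>k. \<forall>t\<in>I. ((deriv_on I ^^ j) g) differentiable (at t within I))"
proof (induction k arbitrary: g)
  case (Suc k)
  have "{..Suc k} = insert 0 (Suc ` {..k})"
    by (rule atMost_Suc_eq_insert_0)
  then have "(\<forall>j\<le>Suc k. P j) \<longleftrightarrow> P 0 \<and> (\<forall>j\<le>k. P (Suc j))" for P
    by (simp only: Ball_def[symmetric] atMost_iff[symmetric]) simp
  then show ?case
    by (simp only: ndiff_on.simps Suc.IH funpow_Suc_right o_apply funpow_0)
qed simp

lemma smooth_curve_on_iff_ndiff: "smooth_curve_on I g \<longleftrightarrow> (\<forall>k. ndiff_on k I g)"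
  unfolding smooth_curve_on_def ndiff_on_iff by auto

lemma ndiff_on_SucD: "ndiff_on (Suc k) I g \<Longrightarrow> ndiff_on k I g"
  by (auto simp: ndiff_on_iff)

lemma ndiff_on_has_vector_derivative:
  assumes "ndiff_on k I g" "t \<in> I"
  shows "(g has_vector_derivative deriv_on I g t) (at t within I)"
  using assms by (cases k) (auto simp: deriv_on_def vector_derivative_works)

lemma deriv_on_cong:
  assumes "\<And>t. t \<in> I \<Longrightarrow> f t = g t" "t \<in> I"
  shows "deriv_on I f t = deriv_on I g t"
proof -
  have "(f has_vector_derivative d) (at t within I) \<longleftrightarrow> (g has_vector_derivative d) (at t within I)" for d
    using has_vector_derivative_transform[OF assms(2), of f g d]
      has_vector_derivative_transform[OF assms(2), of g f d] assms(1) by auto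
  then show ?thesis
    by (simp add: deriv_on_def vector_derivative_def)
qed

text \<open>Derivatives within \<open>I\<close> at points of \<open>I\<close> see only the values on
  \<open>I\<close>. This matters because closed formulas such as that for \<open>E\<close> are
  available only there.\<close>

lemma ndiff_on_cong:
  assumes "\<And>t. t \<in> I \<Longrightarrow> f t = g t"
  shows "ndiff_on k I f \<longleftrightarrow> ndiff_on k I g"
proof -
  have D: "f differentiable (at t within I) \<longleftrightarrow> g differentiable (at t within I)"
    if "\<And>t. t \<in> I \<Longrightarrow> f t = g t" "t \<in> I" for t and f g :: "real \<Rightarrow> 'a"
    using differentiable_transform_within[of f t I 1 g] differentiable_transform_within[of g t I 1 f]
      that by auto
  show ?thesis
    using assms
  proof (induction k arbitrary: f g)
    case 0
    then show ?case using D[OF 0] by auto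
  next
    case (Suc k)
    have "ndiff_on k I (deriv_on I f) = ndiff_on k I (deriv_on I g)"
      by (rule Suc.IH) (rule deriv_on_cong[OF Suc.prems])
    then show ?case using D[OF Suc.prems] by auto
  qed
qed

text \<open>At an isolated point every vector is a derivative within \<open>I\<close>. Without
  isolated points the derivative is unique, so \<open>deriv_on\<close> obeys the usual rules of
  calculus.\<close>

locale perfect_domain =
  fixes I :: "real set"
  assumes islimpt: "\<And>t. t \<in> I \<Longrightarrow> t islimpt I"
begin

lemma deriv_on_eqI:
  assumes "(g has_vector_derivative g') (at t within I)" "t \<in> I"
  shows "deriv_on I g t = g'"
  unfolding deriv_on_def using assms islimpt
  by (intro vector_derivative_within) (auto simp: trivial_limit_within)

text \<open>The inductive step of the closure proofs: an explicit derivative replaces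
  \<open>deriv_on I g\<close>, with which it has to agree only on \<open>I\<close>.\<close>

lemma ndiff_on_SucI:
  assumes "\<And>t. t \<in> I \<Longrightarrow> (g has_vector_derivative g' t) (at t within I)" "ndiff_on k I g'"
  shows "ndiff_on (Suc k) I g"
proof -
  have "ndiff_on k I (deriv_on I g)"
    using assms deriv_on_eqI by (subst ndiff_on_cong[of I _ g']) auto
  with assms(1) show ?thesis
    by (auto intro: differentiableI_vector)
qed

lemma ndiff_on_bounded_linear:
  assumes "bounded_linear h"
  shows "ndiff_on k I g \<Longrightarrow> ndiff_on k I (\<lambda>t. h (g t))"
proof (induction k arbitrary: g)
  case 0
  then show ?case
    using ndiff_on_has_vector_derivative[OF 0]
    by (auto intro!: differentiableI_vector bounded_linear.has_vector_derivative[OF assms])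
next
  case (Suc k)
  then show ?case
    by (intro ndiff_on_SucI[where g' = "\<lambda>t. h (deriv_on I g t)"])
      (auto intro!: bounded_linear.has_vector_derivative[OF assms]
        ndiff_on_has_vector_derivative[OF Suc.prems])
qed

lemma ndiff_on_const: "ndiff_on k I (\<lambda>t. c)"
proof (induction k arbitrary: c)
  case (Suc k)
  then show ?case
    by (intro ndiff_on_SucI[where g' = "\<lambda>t. 0"]) auto
qed auto

lemma ndiff_on_add: "ndiff_on k I f \<Longrightarrow> ndiff_on k I g \<Longrightarrow> ndiff_on k I (\<lambda>t. f t + g t)"
proof (induction k arbitrary: f g)
  case (Suc k)
  then show ?case
    by (intro ndiff_on_SucI[where g' = "\<lambda>t. deriv_on I f t + deriv_on I g t"])
      (auto intro!: has_vector_derivative_add ndiff_on_has_vector_derivative[of "Suc k"])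
qed auto

text \<open>The product rule gives two terms of the same shape, to which the induction hypothesis
  applies. Bilinear maps cover products, \<open>scaleR\<close> and \<open>pip\<close> at
  once.\<close>

lemma ndiff_on_bounded_bilinear:
  assumes "bounded_bilinear h"
  shows "ndiff_on k I f \<Longrightarrow> ndiff_on k I g \<Longrightarrow> ndiff_on k I (\<lambda>t. h (f t) (g t))"
proof (induction k arbitrary: f g)
  case 0
  show ?case
    using 0[THEN ndiff_on_has_vector_derivative]
    by (auto intro!: differentiableI_vector bounded_bilinear.has_vector_derivative[OF assms])
next
  case (Suc k)
  show ?case
  proof (rule ndiff_on_SucI)
    show "((\<lambda>t. h (f t) (g t)) has_vector_derivative
        (h (f t) (deriv_on I g t) + h (deriv_on I f t) (g t))) (at t within I)" if "t \<in> I" for t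
      using that Suc.prems
      by (intro bounded_bilinear.has_vector_derivative[OF assms] ndiff_on_has_vector_derivative)
    show "ndiff_on k I (\<lambda>t. h (f t) (deriv_on I g t) + h (deriv_on I f t) (g t))"
      using Suc.prems by (intro ndiff_on_add Suc.IH Suc.prems[THEN ndiff_on_SucD]) auto
  qed
qed

lemmas ndiff_on_mult = ndiff_on_bounded_bilinear[OF bounded_bilinear_mult]
lemmas ndiff_on_scaleR = ndiff_on_bounded_bilinear[OF bounded_bilinear_scaleR]
lemmas ndiff_on_minus = ndiff_on_bounded_linear[OF bounded_linear_minus[OF bounded_linear_ident]]

lemma ndiff_on_diff: "ndiff_on k I f \<Longrightarrow> ndiff_on k I g \<Longrightarrow> ndiff_on k I (\<lambda>t. f t - g t)"
  using ndiff_on_add[of k f "\<lambda>t. - g t"] ndiff_on_minus[of k g] by simp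

text \<open>The pair is the sum of the images under the two coordinate embeddings, which are bounded
  linear.\<close>

lemma ndiff_on_Pair:
  assumes "ndiff_on k I f" "ndiff_on k I g"
  shows "ndiff_on k I (\<lambda>t. (f t, g t))"
proof -
  have "bounded_linear (\<lambda>x. (x, 0))" "bounded_linear (\<lambda>x. (0, x))"
    by (intro bounded_linear_Pair bounded_linear_ident bounded_linear_zero)+
  from ndiff_on_add[OF ndiff_on_bounded_linear[OF this(1) assms(1)]
      ndiff_on_bounded_linear[OF this(2) assms(2)]]
  show ?thesis by (simp only: add_Pair add_0_left add_0_right)
qed

lemma ndiff_on_power: "ndiff_on k I f \<Longrightarrow> ndiff_on k I (\<lambda>t. f t ^ j :: real)"
  by (induction j) (auto intro: ndiff_on_const ndiff_on_mult)

text \<open>The derivative contains the reciprocal of \<open>f\<close> again, but one derivative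
  fewer is then asked of it.\<close>

lemma ndiff_on_inverse:
  fixes f :: "real \<Rightarrow> real"
  assumes "\<And>t. t \<in> I \<Longrightarrow> f t \<noteq> 0"
  shows "ndiff_on k I f \<Longrightarrow> ndiff_on k I (\<lambda>t. inverse (f t))"
proof (induction k)
  case 0
  then show ?case using assms by (auto intro: differentiable_inverse)
next
  case (Suc k)
  show ?case
  proof (rule ndiff_on_SucI)
    show "((\<lambda>t. inverse (f t)) has_vector_derivative
        - (inverse (f t) * deriv_on I f t * inverse (f t))) (at t within I)" if "t \<in> I" for t
      using that ndiff_on_has_vector_derivative[OF Suc.prems that] assms
      by (auto intro!: DERIV_inverse' simp flip: has_real_derivative_iff_has_vector_derivative)
    show "ndiff_on k I (\<lambda>t. - (inverse (f t) * deriv_on I f t * inverse (f t)))"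
      using Suc.prems
      by (intro ndiff_on_minus ndiff_on_mult Suc.IH ndiff_on_SucD[OF Suc.prems]) simp
  qed
qed

text \<open>The derivative is built from \<open>f'\<close> and the reciprocal of
  \<open>sqrt f\<close>, of which one derivative fewer is asked; the induction hypothesis and
  \<open>ndiff_on_inverse\<close> supply it.\<close>

lemma ndiff_on_sqrt:
  fixes f :: "real \<Rightarrow> real"
  assumes pos: "\<And>t. t \<in> I \<Longrightarrow> 0 < f t"
  shows "ndiff_on k I f \<Longrightarrow> ndiff_on k I (\<lambda>t. sqrt (f t))"
proof -
  have D: "((\<lambda>t. sqrt (f t)) has_vector_derivative
      inverse (sqrt (f t)) / 2 * deriv_on I f t) (at t within I)" if "t \<in> I" "ndiff_on k I f" for t k
    using that ndiff_on_has_vector_derivative[OF that(2,1)] pos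
    unfolding has_real_derivative_iff_has_vector_derivative[symmetric]
    by (intro DERIV_chain2[OF DERIV_real_sqrt]) auto
  show "ndiff_on k I f \<Longrightarrow> ndiff_on k I (\<lambda>t. sqrt (f t))"
  proof (induction k)
    case 0
    then show ?case using D[OF _ 0] by (auto intro: differentiableI_vector)
  next
    case (Suc k)
    have "ndiff_on k I (\<lambda>t. inverse (sqrt (f t)) / 2 * deriv_on I f t)"
      unfolding divide_inverse
    proof (intro ndiff_on_mult ndiff_on_const ndiff_on_inverse)
      show "sqrt (f t) \<noteq> 0" if "t \<in> I" for t
        using pos[OF that] by simp
      show "ndiff_on k I (\<lambda>t. sqrt (f t))"
        by (rule Suc.IH) (rule ndiff_on_SucD[OF Suc.prems])
      show "ndiff_on k I (deriv_on I f)"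
        using Suc.prems by simp
    qed
    with D[OF _ Suc.prems] show ?case
      by (rule ndiff_on_SucI)
  qed
qed

lemmas ndiff_on_intros = ndiff_on_const ndiff_on_add ndiff_on_diff ndiff_on_minus ndiff_on_mult
  ndiff_on_scaleR ndiff_on_Pair ndiff_on_power ndiff_on_inverse ndiff_on_sqrt

end

text \<open>A connected set with more than one point has no isolated points, and a singleton has
  empty interior.\<close>

lemma perfect_domain_interval:
  assumes "is_interval I" "interior I \<noteq> {}"
  shows "perfect_domain I"
proof
  fix t assume "t \<in> I"
  then show "t islimpt I"
    using assms by (intro connected_imp_perfect is_interval_connected)
      (auto simp: interior_singleton)
qed

subsection \<open>The triple product\<close>

text \<open>Laplace expansion along the first row, obtained by building up the permutations one
  index at a time.\<close>

lemma det_4: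
  "det (A :: 'a::comm_ring_1^4^4) =
    A$1$1 * (A$2$2 * (A$3$3 * A$4$4 - A$3$4 * A$4$3)
           - A$2$3 * (A$3$2 * A$4$4 - A$3$4 * A$4$2)
           + A$2$4 * (A$3$2 * A$4$3 - A$3$3 * A$4$2))
  - A$1$2 * (A$2$1 * (A$3$3 * A$4$4 - A$3$4 * A$4$3)
           - A$2$3 * (A$3$1 * A$4$4 - A$3$4 * A$4$1)
           + A$2$4 * (A$3$1 * A$4$3 - A$3$3 * A$4$1))
  + A$1$3 * (A$2$1 * (A$3$2 * A$4$4 - A$3$4 * A$4$2)
           - A$2$2 * (A$3$1 * A$4$4 - A$3$4 * A$4$1)
           + A$2$4 * (A$3$1 * A$4$2 - A$3$2 * A$4$1))
  - A$1$4 * (A$2$1 * (A$3$2 * A$4$3 - A$3$3 * A$4$2)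
           - A$2$2 * (A$3$1 * A$4$3 - A$3$3 * A$4$1)
           + A$2$3 * (A$3$1 * A$4$2 - A$3$2 * A$4$1))"
proof -
  have f1234: "finite {2::4, 3, 4}" "1 \<notin> {2::4, 3, 4}"
    and f234: "finite {3::4, 4}" "2 \<notin> {3::4, 4}"
    and f34: "finite {4::4}" "3 \<notin> {4::4}"
    by auto
  show ?thesis
    unfolding det_def UNIV_4
    unfolding sum_over_permutations_insert[OF f1234]
    unfolding sum_over_permutations_insert[OF f234]
    unfolding sum_over_permutations_insert[OF f34]
    unfolding permutes_sing
    by (simp add: sign_swap_id permutation_swap_id sign_compose sign_id permutation_compose
        transpose_apply_other algebra_simps)
qed

text \<open>The defining property is tested on the axis vectors. Components 1 and 2 are the negated
  cofactors, because \<open>pip\<close> is negative in these directions.\<close>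

lemma triple_nth:
  "triple u v w $ 1 =
     - (u$2 * (v$3 * w$4 - v$4 * w$3) - u$3 * (v$2 * w$4 - v$4 * w$2) + u$4 * (v$2 * w$3 - v$3 * w$2))"
  "triple u v w $ 2 =
     u$1 * (v$3 * w$4 - v$4 * w$3) - u$3 * (v$1 * w$4 - v$4 * w$1) + u$4 * (v$1 * w$3 - v$3 * w$1)"
  "triple u v w $ 3 =
     u$1 * (v$2 * w$4 - v$4 * w$2) - u$2 * (v$1 * w$4 - v$4 * w$1) + u$4 * (v$1 * w$2 - v$2 * w$1)"
  "triple u v w $ 4 =
     - (u$1 * (v$2 * w$3 - v$3 * w$2) - u$2 * (v$1 * w$3 - v$3 * w$1) + u$3 * (v$1 * w$2 - v$2 * w$1))"
  using pip_triple[of "axis 1 1" u v w] pip_triple[of "axis 2 1" u v w]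
    pip_triple[of "axis 3 1" u v w] pip_triple[of "axis 4 1" u v w]
  by (simp_all add: pip_def det_4 vector_4_nth axis_def)

lemma triple_self [simp]:
  "triple u u v = 0"
  "triple u v v = 0"
  "triple v u v = 0"
  by (simp_all add: vec_eq_iff forall_4 triple_nth algebra_simps)

lemma triple_cycle: "triple u v w = triple w u v"
  by (simp add: vec_eq_iff forall_4 triple_nth algebra_simps)

lemma triple_add:
  "triple (u + u') v w = triple u v w + triple u' v w"
  "triple u (v + v') w = triple u v w + triple u v' w"
  "triple u v (w + w') = triple u v w + triple u v w'"
  by (simp_all add: vec_eq_iff forall_4 triple_nth algebra_simps)

lemma triple_scaleR:
  "triple (c *\<^sub>R u) v w = c *\<^sub>R triple u v w"
  "triple u (c *\<^sub>R v) w = c *\<^sub>R triple u v w"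
  "triple u v (c *\<^sub>R w) = c *\<^sub>R triple u v w"
  by (simp_all add: vec_eq_iff forall_4 triple_nth algebra_simps)

lemma triple_diff:
  "triple (u - u') v w = triple u v w - triple u' v w"
  "triple u (v - v') w = triple u v w - triple u v' w"
  "triple u v (w - w') = triple u v w - triple u v w'"
  by (simp_all add: vec_eq_iff forall_4 triple_nth algebra_simps)

lemma pip_commute: "pip u w = pip w u"
  by (simp add: pip_def)

lemma bounded_bilinear_pip: "bounded_bilinear pip"
proof -
  have "bilinear pip"
    by (auto simp: bilinear_def pip_def intro!: linearI simp: algebra_simps)
  then show ?thesis
    by (simp add: bilinear_conv_bounded_bilinear)
qed

interpretation pip: bounded_bilinear pip
  by (rule bounded_bilinear_pip)

lemma pip_triple_self:
  "pip (triple u v w) u = 0"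
  "pip (triple u v w) v = 0"
  "pip (triple u v w) w = 0"
  by (simp_all add: pip_def triple_nth algebra_simps)

text \<open>The right-hand side is the Gram determinant of the three vectors. Its sign is positive
  because the diagonal matrix of \<open>pip\<close> has determinant 1.\<close>

lemma pip_triple_triple:
  "pip (triple u v w) (triple u v w) =
     pip u u * (pip v v * pip w w - (pip v w)\<^sup>2)
   - pip u v * (pip u v * pip w w - pip u w * pip v w)
   + pip u w * (pip u v * pip v w - pip v v * pip u w)"
  unfolding pip_def triple_nth by algebra

text \<open>The analogue in index 2 of the rule \<open>(u \<times> v) \<times> v = (u \<bullet> v) v - (v \<bullet> v) u\<close>.\<close>

lemma triple_triple:
  "triple (triple u v w) v w =
     (pip u v * pip w w - pip u w * pip v w) *\<^sub>R v
   + (pip u w * pip v v - pip u v * pip v w) *\<^sub>R w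
   - (pip v v * pip w w - (pip v w)\<^sup>2) *\<^sub>R u"
  unfolding vec_eq_iff forall_4 vector_minus_component vector_add_component vector_scaleR_component
    triple_nth pip_def real_scaleR_def
  by (intro conjI; algebra)

lemma has_vector_derivative_vec:
  fixes f :: "real \<Rightarrow> real^'n"
  assumes "\<And>i. ((\<lambda>t. f t $ i) has_real_derivative f' $ i) (at x within S)"
  shows "(f has_vector_derivative f') (at x within S)"
  unfolding has_vector_derivative_def has_derivative_componentwise_within[of f]
  using assms by (auto simp: Basis_vec_def inner_axis has_field_derivative_def mult.commute[of _ "f' $ _"]
    mult_commute_abs)

lemma has_vector_derivative_nth:
  fixes f :: "real \<Rightarrow> real^'n"
  assumes "(f has_vector_derivative f') (at x within S)"
  shows "((\<lambda>t. f t $ i) has_real_derivative f' $ i) (at x within S)"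
  using bounded_linear.has_vector_derivative[OF bounded_linear_vec_nth assms]
  by (simp add: has_real_derivative_iff_has_vector_derivative)

text \<open>Each coordinate is a cubic polynomial in the coordinates of the arguments, so the scalar
  product rule suffices.\<close>

lemma has_vector_derivative_triple:
  assumes "(f has_vector_derivative f') (at x within S)"
    and "(g has_vector_derivative g') (at x within S)"
    and "(h has_vector_derivative h') (at x within S)"
  shows "((\<lambda>t. triple (f t) (g t) (h t)) has_vector_derivative
    (triple f' (g x) (h x) + triple (f x) g' (h x) + triple (f x) (g x) h')) (at x within S)"
proof (rule has_vector_derivative_vec)
  note D = assms[THEN has_vector_derivative_nth]
  have "\<forall>i. ((\<lambda>t. triple (f t) (g t) (h t) $ i) has_real_derivative
    (triple f' (g x) (h x) + triple (f x) g' (h x) + triple (f x) (g x) h') $ i) (at x within S)"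
    unfolding forall_4 vector_add_component triple_nth
    by (intro conjI; auto intro!: derivative_eq_intros D simp: algebra_simps)
  then show "((\<lambda>t. triple (f t) (g t) (h t) $ i) has_real_derivative
    (triple f' (g x) (h x) + triple (f x) g' (h x) + triple (f x) (g x) h') $ i) (at x within S)" for i
    by blast
qed

text \<open>The frame at a single parameter value. The vector \<open>m\<close> below completes it to
  a pseudo-orthonormal basis in which \<open>g\<close> and \<open>m\<close> are timelike.\<close>

locale timelike_frame =
  fixes g u v :: "real^4"
  assumes norms: "pip g g = -1" "pip u u = 1" "pip v v = 1"
    and orthogonal: "pip g u = 0" "pip g v = 0" "pip u v = 0"
begin

lemma orthogonal': "pip u g = 0" "pip v g = 0" "pip v u = 0"
  using orthogonal by (simp_all add: pip_commute)

lemmas products = norms orthogonal orthogonal'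

lemma pip_combination:
  "pip (x *\<^sub>R g + y *\<^sub>R u + z *\<^sub>R v) (x' *\<^sub>R g + y' *\<^sub>R u + z' *\<^sub>R v) = y * y' + z * z' - x * x'"
  by (simp add: pip.add_left pip.add_right pip.scaleR_left pip.scaleR_right products)

definition m where "m = triple g u v"

lemma pip_m: "pip m m = -1" "pip m g = 0" "pip m u = 0" "pip m v = 0"
  by (simp_all add: m_def pip_triple_triple pip_triple_self products)

text \<open>By orthogonality only the last term of \<open>triple_triple\<close> survives for each
  cyclic rotation of the frame; the other orders follow by antisymmetry.\<close>

lemma triple_m:
  "triple u m v = g" "triple g m v = u" "triple g u m = v"
  "triple v m g = - u" "triple u m g = v" "triple m u v = - g"
proof -
  have rotated: "triple u v g = m" "triple v g u = m"
    using triple_cycle[of u v g] triple_cycle[of v g u] by (simp_all add: m_def)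
  have *: "triple m u v = - g" "triple m v g = u" "triple m g u = v"
    using triple_triple[of g u v] triple_triple[of u v g] triple_triple[of v g u]
    unfolding rotated m_def[symmetric] by (simp_all add: products)
  have "triple u m v = - triple m u v" "triple g m v = triple m v g" "triple g u m = triple m g u"
    "triple v m g = - triple m v g" "triple u m g = triple m g u"
    by (simp_all add: vec_eq_iff forall_4 triple_nth algebra_simps)
  then show "triple u m v = g" "triple g m v = u" "triple g u m = v"
    "triple v m g = - u" "triple u m g = v" "triple m u v = - g"
    by (simp_all add: *)
qed

text \<open>The shape fits \<open>triple E \<mu> \<eta>\<close>: \<open>E\<close> may have all three
  components, whereas \<open>\<eta>\<close> has none along \<open>f1\<close>.\<close>

lemma triple_combination:
  "triple (x *\<^sub>R g + y *\<^sub>R u + z *\<^sub>R v) m (p *\<^sub>R g + q *\<^sub>R v) =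
    (y * q) *\<^sub>R g + (x * q - z * p) *\<^sub>R u + (y * p) *\<^sub>R v"
  by (simp add: triple_add triple_scaleR triple_m algebra_simps)

end

text \<open>Over the denominator \<open>g * sqrt g\<close> the numerator is free of roots, so that
  comparing coefficients later becomes a polynomial identity.\<close>

lemma DERIV_divide_sqrt:
  assumes "(f has_real_derivative f') (at x within S)"
    and "(g has_real_derivative g') (at x within S)"
    and "0 < g x"
  shows "((\<lambda>t. f t / sqrt (g t)) has_real_derivative
    (f' * g x - f x * g' / 2) / (g x * sqrt (g x))) (at x within S)"
proof -
  have "sqrt (g x) ^ 2 = g x" "sqrt (g x) \<noteq> 0"
    using assms(3) by simp_all
  then have e: "(f' * sqrt (g x) - f x * (inverse (sqrt (g x)) / 2 * g')) / (sqrt (g x) * sqrt (g x))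
     = (f' * g x - f x * g' / 2) / (g x * sqrt (g x))"
    by (simp add: field_simps power2_eq_square)
  show ?thesis
    unfolding e[symmetric]
    using assms by (intro DERIV_divide DERIV_chain2[OF DERIV_real_sqrt]) auto
qed

subsection \<open>The evolute\<close>

text \<open>With \<open>E = (l n\<^sup>2 g - w f1 - l n a f2) / sqrt G\<close> and \<open>G1 = G'\<close>, these are the three components of
  \<open>E'\<close> along \<open>g\<close>, \<open>f1\<close>, \<open>f2\<close>, cleared of the denominator \<open>G * sqrt G\<close>.\<close>

lemma evolute_polynomial_identities:
  fixes a a1 a2 l l1 n n1 n2 :: real
  defines "w \<equiv> a * n1 - n * a1"
  defines "w1 \<equiv> a * n2 - n * a2"
  defines "h \<equiv> n\<^sup>2 - a\<^sup>2"
  defines "G \<equiv> l\<^sup>2 * n\<^sup>2 * h - w\<^sup>2"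
  defines "G1 \<equiv> 2 * l * n * (l1 * n + l * n1) * h + l\<^sup>2 * n\<^sup>2 * (2 * n * n1 - 2 * a * a1) - 2 * w * w1"
  defines "N \<equiv> n * (2 * l * a1 * n1 - n * (- a1 * l1 + l * a2))
      - a * (l^3 * n\<^sup>2 + n * l1 * n1 + l * (2 * n1\<^sup>2 - n * n2))"
  shows "(l1 * n * n + 2 * l * n * n1) * G - l * n * n * G1 / 2 = N * w * n"
    and "(- w1 + l * n * a * l) * G + w * G1 / 2 = - (N * l * n * h)"
    and "(- (l1 * n * a + l * n1 * a + l * n * a1) - w * l) * G + l * n * a * G1 / 2 = - (N * w * a)"
  unfolding w_def w1_def h_def G_def G1_def N_def by algebra+

theorem theorem5p3:
  fixes I :: "real set"
    and \<gamma> f1 f2 \<mu> E \<eta> \<mu>E :: "real \<Rightarrow> real^4"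
    and \<alpha> l n \<alpha>' \<alpha>'' l' n' n'' W \<alpha>E lE nE :: "real \<Rightarrow> real"
  assumes interval: "is_interval I" "interior I \<noteq> {}"
    and framed: "timelike_framed_immersion I \<gamma> f1 f2"
    and curvature: "timelike_curvature I \<gamma> f1 f2 \<alpha> l (\<lambda>t. 0) n"
    and n_gt: "\<And>t. t \<in> I \<Longrightarrow> (n t)\<^sup>2 > (\<alpha> t)\<^sup>2"
    and disc_neg: "\<And>t. t \<in> I \<Longrightarrow> evolute_disc I \<alpha> l n t < 0"
    and derivs: "\<alpha>' = deriv_on I \<alpha>" "\<alpha>'' = deriv_on I \<alpha>'" "l' = deriv_on I l"
      "n' = deriv_on I n" "n'' = deriv_on I n'"
    and mu: "\<mu> = (\<lambda>t. triple (\<gamma> t) (f1 t) (f2 t))"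
    and evolute: "E = AdS_evolute I \<gamma> f1 f2 \<alpha> l n"
    and W: "W = (\<lambda>t. \<alpha> t * n' t - n t * \<alpha>' t)"
    and eta: "\<eta> = (\<lambda>t. (\<alpha> t *\<^sub>R \<gamma> t - n t *\<^sub>R f2 t) /\<^sub>R sqrt ((n t)\<^sup>2 - (\<alpha> t)\<^sup>2))"
    and muE: "\<mu>E = (\<lambda>t. (W t *\<^sub>R (n t *\<^sub>R \<gamma> t - \<alpha> t *\<^sub>R f2 t)
                        - (l t * n t * ((n t)\<^sup>2 - (\<alpha> t)\<^sup>2)) *\<^sub>R f1 t)
        /\<^sub>R (sqrt ((n t)\<^sup>2 - (\<alpha> t)\<^sup>2)
            * sqrt ((l t)\<^sup>2 * (n t)\<^sup>2 * ((n t)\<^sup>2 - (\<alpha> t)\<^sup>2) - (W t)\<^sup>2)))"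
    and alphaE: "\<alpha>E = (\<lambda>t. sqrt ((n t)\<^sup>2 - (\<alpha> t)\<^sup>2)
        * ((n t * (2 * l t * \<alpha>' t * n' t - n t * (- \<alpha>' t * l' t + l t * \<alpha>'' t))
            - \<alpha> t * ((l t)^3 * (n t)\<^sup>2 + n t * l' t * n' t
                     + l t * (2 * (n' t)\<^sup>2 - n t * n'' t)))
           / ((l t)\<^sup>2 * (n t)\<^sup>2 * ((n t)\<^sup>2 - (\<alpha> t)\<^sup>2) - (W t)\<^sup>2)))"
    and ellE: "lE = (\<lambda>t. - sqrt ((n t)\<^sup>2 - (\<alpha> t)\<^sup>2))"
    and nE: "nE = (\<lambda>t. sqrt ((l t)\<^sup>2 * (n t)\<^sup>2 * ((n t)\<^sup>2 - (\<alpha> t)\<^sup>2) - (W t)\<^sup>2)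
                       / ((\<alpha> t)\<^sup>2 - (n t)\<^sup>2))"
  shows "spacelike_framed_base_curve I E
    \<and> spacelike_framed_immersion I E \<mu> \<eta>
    \<and> (\<forall>t\<in>I. \<mu>E t = triple (E t) (\<mu> t) (\<eta> t))
    \<and> spacelike_curvature I E \<mu> \<eta> \<alpha>E lE (\<lambda>t. 0) nE"
proof -
  interpret perfect_domain I
    using interval by (rule perfect_domain_interval)

  \<comment> \<open>The two radicands and the frame at each parameter\<close>
  define h where "h t = (n t)\<^sup>2 - (\<alpha> t)\<^sup>2" for t
  define G where "G t = (l t)\<^sup>2 * (n t)\<^sup>2 * h t - (W t)\<^sup>2" for t
  have h_pos: "0 < h t" and G_pos: "0 < G t" and disc: "evolute_disc I \<alpha> l n t = - G t"
    if "t \<in> I" for t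
    using n_gt[OF that] disc_neg[OF that] by (simp_all add: h_def G_def W derivs evolute_disc_def)

  have frame: "timelike_frame (\<gamma> t) (f1 t) (f2 t)" if "t \<in> I" for t
    using framed that
    by unfold_locales
      (auto simp: timelike_framed_immersion_def framed_immersion_def AdS3_def S32_def Delta5_def)
  have mu_m: "\<mu> t = timelike_frame.m (\<gamma> t) (f1 t) (f2 t)" if "t \<in> I" for t
    by (simp add: mu timelike_frame.m_def[OF frame[OF that]])
  have pip_mu: "pip (\<mu> t) (\<mu> t) = -1" "pip (\<mu> t) (\<gamma> t) = 0" "pip (\<mu> t) (f1 t) = 0"
    "pip (\<mu> t) (f2 t) = 0" if "t \<in> I" for t
    using timelike_frame.pip_m[OF frame[OF that]] that by (simp_all add: mu_m)

  \<comment> \<open>Derivative of \<open>\<mu>\<close>, and smoothness of \<open>\<mu>\<close> and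
    the curvature\<close>
  have smooth: "ndiff_on k I (\<lambda>t. (\<gamma> t, f1 t, f2 t))" for k
    using framed by (simp add: timelike_framed_immersion_def framed_immersion_def
        smooth_immersion_on_def smooth_curve_on_iff_ndiff)
  have smooth_frame: "ndiff_on k I \<gamma>" "ndiff_on k I f1" "ndiff_on k I f2" for k
    using ndiff_on_bounded_linear[OF bounded_linear_fst smooth]
      ndiff_on_bounded_linear[OF bounded_linear_fst_comp[OF bounded_linear_snd] smooth]
      ndiff_on_bounded_linear[OF bounded_linear_snd_comp[OF bounded_linear_snd] smooth]
    by simp_all
  have smooth_deriv: "ndiff_on k I (deriv_on I f)" if "\<And>k. ndiff_on k I f"
    for k and f :: "real \<Rightarrow> 'z::real_normed_vector"
    using that[of "Suc k"] by simp

  have frenet: "deriv_on I \<gamma> t = \<alpha> t *\<^sub>R \<mu> t" "deriv_on I f1 t = l t *\<^sub>R f2 t"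
    "deriv_on I f2 t = - l t *\<^sub>R f1 t + n t *\<^sub>R \<mu> t" if "t \<in> I" for t
    using curvature that by (simp_all add: timelike_curvature_def Let_def mu)
  have D_frame: "(\<gamma> has_vector_derivative \<alpha> t *\<^sub>R \<mu> t) (at t within I)"
    "(f1 has_vector_derivative l t *\<^sub>R f2 t) (at t within I)"
    "(f2 has_vector_derivative - l t *\<^sub>R f1 t + n t *\<^sub>R \<mu> t) (at t within I)" if "t \<in> I" for t
    using smooth_frame[THEN ndiff_on_has_vector_derivative, OF that]
    unfolding frenet[OF that] by blast+

  have D_mu: "(\<mu> has_vector_derivative - \<alpha> t *\<^sub>R \<gamma> t + n t *\<^sub>R f2 t) (at t within I)"
    if "t \<in> I" for t
  proof -
    interpret timelike_frame "\<gamma> t" "f1 t" "f2 t" by (rule frame[OF that])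
    \<comment> \<open>In the product rule the terms with a repeated entry vanish; what remains is
      \<open>triple \<mu> f1 f2 = - \<gamma>\<close> and
      \<open>triple \<gamma> f1 \<mu> = f2\<close>.\<close>
    have "triple (\<alpha> t *\<^sub>R \<mu> t) (f1 t) (f2 t) + triple (\<gamma> t) (l t *\<^sub>R f2 t) (f2 t)
        + triple (\<gamma> t) (f1 t) (- l t *\<^sub>R f1 t + n t *\<^sub>R \<mu> t) = - \<alpha> t *\<^sub>R \<gamma> t + n t *\<^sub>R f2 t"
      by (simp add: triple_diff triple_scaleR mu_m[OF that] triple_m)
    then show ?thesis
      using has_vector_derivative_triple[OF D_frame[OF that]] by (simp add: mu)
  qed

  \<comment> \<open>The curvature is given only through the equations it satisfies; its smoothness
    has to be read off these products. The minus signs occur because \<open>\<mu>\<close> is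
    timelike.\<close>
  have curvature_eqs: "\<alpha> t = - pip (deriv_on I \<gamma> t) (\<mu> t)" "l t = pip (deriv_on I f1 t) (f2 t)"
    "n t = - pip (deriv_on I f2 t) (\<mu> t)" if "t \<in> I" for t
    using that pip_mu[OF that] timelike_frame.norms[OF frame[OF that]]
    by (simp_all add: frenet pip.diff_left pip.scaleR_left pip_commute[of "f1 t" "\<mu> t"])
  have smooth_\<alpha>n: "ndiff_on k I \<alpha>" "ndiff_on k I n" if "ndiff_on k I \<mu>" for k
  proof -
    have "ndiff_on k I (\<lambda>t. - pip (deriv_on I \<gamma> t) (\<mu> t))" "ndiff_on k I (\<lambda>t. - pip (deriv_on I f2 t) (\<mu> t))"
      by (intro ndiff_on_minus ndiff_on_bounded_bilinear[OF bounded_bilinear_pip] smooth_deriv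
          smooth_frame that)+
    then show "ndiff_on k I \<alpha>" "ndiff_on k I n"
      by (simp_all only: ndiff_on_cong[OF curvature_eqs(1)] ndiff_on_cong[OF curvature_eqs(3)])
  qed
  \<comment> \<open>Bootstrapping: \<open>\<alpha>\<close> and \<open>n\<close> are as smooth as \<open>\<mu>\<close>, and \<open>\<mu>'\<close> is as smooth as \<open>\<alpha>\<close> and \<open>n\<close>.\<close>
  have smooth_\<mu>: "ndiff_on k I \<mu>" for k
  proof (induction k)
    case 0
    show ?case unfolding ndiff_on.simps using differentiableI_vector[OF D_mu] by blast
  next
    case (Suc k)
    show ?case
      by (rule ndiff_on_SucI[OF D_mu], assumption)
        (intro ndiff_on_add ndiff_on_scaleR ndiff_on_minus smooth_frame smooth_\<alpha>n Suc)
  qed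
  have smooth_l: "ndiff_on k I l" for k
    by (subst ndiff_on_cong[OF curvature_eqs(2)], assumption)
      (intro ndiff_on_bounded_bilinear[OF bounded_bilinear_pip] smooth_deriv smooth_frame)
  note smooth_curv = smooth_\<alpha>n[OF smooth_\<mu>] smooth_l
  have smooth_\<alpha>'n': "ndiff_on k I \<alpha>'" "ndiff_on k I n'" for k
    unfolding derivs by (intro smooth_deriv smooth_curv)+
  have smooth_h: "ndiff_on k I h" for k
    unfolding h_def by (intro ndiff_on_intros smooth_curv)
  have smooth_W: "ndiff_on k I W" for k
    unfolding W by (intro ndiff_on_intros smooth_curv smooth_\<alpha>'n')
  have smooth_G: "ndiff_on k I G" for k
    unfolding G_def by (intro ndiff_on_intros smooth_curv smooth_h smooth_W)

  \<comment> \<open>Coordinates of \<open>E\<close>, \<open>\<eta>\<close> and \<open>\<mu>E\<close>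
    along \<open>\<gamma>\<close>, \<open>f1\<close>, \<open>f2\<close>\<close>
  have E_eq: "E t = (l t * n t * n t / sqrt (G t)) *\<^sub>R \<gamma> t + (- W t / sqrt (G t)) *\<^sub>R f1 t
      + (- (l t * n t * \<alpha> t) / sqrt (G t)) *\<^sub>R f2 t" if "t \<in> I" for t
    using G_pos[OF that]
    by (simp add: evolute AdS_evolute_def total_evolute_def disc[OF that] W derivs algebra_simps
        divide_inverse)
  have eta_eq: "\<eta> = (\<lambda>t. (\<alpha> t / sqrt (h t)) *\<^sub>R \<gamma> t + (- n t / sqrt (h t)) *\<^sub>R f2 t)"
    by (simp add: eta h_def algebra_simps divide_inverse fun_eq_iff)
  have muE_eq: "\<mu>E t = (W t * n t / (sqrt (h t) * sqrt (G t))) *\<^sub>R \<gamma> t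
      + (- (l t * n t * h t) / (sqrt (h t) * sqrt (G t))) *\<^sub>R f1 t
      + (- (W t * \<alpha> t) / (sqrt (h t) * sqrt (G t))) *\<^sub>R f2 t" for t
    by (simp add: muE flip: h_def G_def) (simp add: algebra_simps divide_inverse)

  have muE_triple: "\<mu>E t = triple (E t) (\<mu> t) (\<eta> t)" if "t \<in> I" for t
  proof -
    \<comment> \<open>Only the \<open>f1\<close> coefficient of the triple product involves the
      definition of \<open>h\<close>.\<close>
    have "l t * n t * h t = l t * n t * n t * n t - l t * n t * \<alpha> t * \<alpha> t"
      by (simp add: h_def algebra_simps power2_eq_square)
    then show ?thesis
      unfolding muE_eq E_eq[OF that] eta_eq mu_m[OF that]
        timelike_frame.triple_combination[OF frame[OF that]]
      by (simp add: divide_simps) (simp add: algebra_simps)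
  qed

  \<comment> \<open>Derivatives of the curvature functions and of \<open>h\<close>,
    \<open>W\<close>, \<open>G\<close>\<close>
  have real_D: "(f has_real_derivative deriv_on I f t) (at t within I)"
    if "t \<in> I" "\<And>k. ndiff_on k I f" for t and f :: "real \<Rightarrow> real"
    using ndiff_on_has_vector_derivative[OF that(2,1)]
    by (simp add: has_real_derivative_iff_has_vector_derivative)
  have D_curv: "(\<alpha> has_real_derivative \<alpha>' t) (at t within I)" "(n has_real_derivative n' t) (at t within I)"
    "(l has_real_derivative l' t) (at t within I)" "(\<alpha>' has_real_derivative \<alpha>'' t) (at t within I)"
    "(n' has_real_derivative n'' t) (at t within I)" if "t \<in> I" for t
    using real_D[OF that] smooth_curv smooth_\<alpha>'n' unfolding derivs by blast+
  have D_h: "(h has_real_derivative 2 * n t * n' t - 2 * \<alpha> t * \<alpha>' t) (at t within I)" if "t \<in> I" for t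
    unfolding h_def by (auto intro!: derivative_eq_intros D_curv that)
  \<comment> \<open>The two products of \<open>\<alpha>'\<close> and \<open>n'\<close>
    cancel.\<close>
  have D_W: "(W has_real_derivative \<alpha> t * n'' t - n t * \<alpha>'' t) (at t within I)" if "t \<in> I" for t
    unfolding W by (auto intro!: derivative_eq_intros D_curv that)
  define G' where "G' t = 2 * l t * n t * (l' t * n t + l t * n' t) * h t
    + (l t)\<^sup>2 * (n t)\<^sup>2 * (2 * n t * n' t - 2 * \<alpha> t * \<alpha>' t)
    - 2 * W t * (\<alpha> t * n'' t - n t * \<alpha>'' t)" for t
  have D_G: "(G has_real_derivative G' t) (at t within I)" if "t \<in> I" for t
    unfolding G_def G'_def
    by (auto intro!: derivative_eq_intros D_curv D_h D_W that simp: algebra_simps power2_eq_square)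

  \<comment> \<open>Frenet equations of the new frame\<close>
  have D_eta: "(\<eta> has_vector_derivative lE t *\<^sub>R \<mu> t + nE t *\<^sub>R \<mu>E t) (at t within I)" if "t \<in> I" for t
  proof -
    define r where "r = sqrt (h t)"
    define q where "q = sqrt (G t)"
    have r: "r * r = h t" "0 < r" "0 < h t" and q: "0 < q"
      using h_pos[OF that] G_pos[OF that] by (simp_all add: r_def q_def)
    \<comment> \<open>\<open>c\<close> and \<open>d\<close> are the derivatives of the two
      coefficients of \<open>\<eta>\<close>, kept in the shape of \<open>DERIV_divide_sqrt\<close>;
      hence the double minus in \<open>d\<close>.\<close>
    define c where "c = (\<alpha>' t * h t - \<alpha> t * (2 * n t * n' t - 2 * \<alpha> t * \<alpha>' t) / 2) / (h t * r)"
    define d where "d = (- n' t * h t - - n t * (2 * n t * n' t - 2 * \<alpha> t * \<alpha>' t) / 2) / (h t * r)"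
    have D: "(\<eta> has_vector_derivative
        ((\<alpha> t / r) *\<^sub>R (\<alpha> t *\<^sub>R \<mu> t) + c *\<^sub>R \<gamma> t)
      + ((- n t / r) *\<^sub>R (- l t *\<^sub>R f1 t + n t *\<^sub>R \<mu> t) + d *\<^sub>R f2 t)) (at t within I)"
      unfolding eta_eq c_def d_def r_def
      by (intro has_vector_derivative_add has_vector_derivative_scaleR DERIV_divide_sqrt DERIV_minus
          D_curv D_h D_frame that h_pos)
    \<comment> \<open>Coefficients along \<open>\<gamma>\<close>, \<open>f2\<close>,
      \<open>f1\<close> and \<open>\<mu>\<close>, in this order.\<close>
    have c: "c = nE t * (W t * n t / (r * q))" and d: "d = nE t * (- (W t * \<alpha> t) / (r * q))"
      and e: "n t * l t / r = nE t * (- (l t * n t * h t) / (r * q))"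
      and f: "(\<alpha> t * \<alpha> t - n t * n t) / r = lE t"
    proof -
      have nE': "nE t = - (q / h t)"
        by (simp add: nE q_def G_def h_def minus_divide_right)
      have lE': "lE t = - r"
        by (simp add: ellE r_def h_def)
      \<comment> \<open>Both numerators collapse to multiples of \<open>W\<close>, which is what
        makes them proportional to the coefficients of \<open>\<mu>E\<close>.\<close>
      have c_num: "\<alpha>' t * h t - \<alpha> t * (2 * n t * n' t - 2 * \<alpha> t * \<alpha>' t) / 2 = - (W t * n t)"
        and d_num: "- n' t * h t - - n t * (2 * n t * n' t - 2 * \<alpha> t * \<alpha>' t) / 2 = W t * \<alpha> t"
        by (simp_all add: h_def W field_simps power2_eq_square)
      show "c = nE t * (W t * n t / (r * q))" "d = nE t * (- (W t * \<alpha> t) / (r * q))"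
        "n t * l t / r = nE t * (- (l t * n t * h t) / (r * q))"
        unfolding c_def d_def c_num d_num nE' using r q by (simp_all add: field_simps)
      have "\<alpha> t * \<alpha> t - n t * n t = - (r * r)"
        by (simp add: r(1) h_def power2_eq_square)
      then show "(\<alpha> t * \<alpha> t - n t * n t) / r = lE t"
        unfolding lE' using r(2) by simp
    qed
    have "((\<alpha> t / r) *\<^sub>R (\<alpha> t *\<^sub>R \<mu> t) + c *\<^sub>R \<gamma> t)
        + ((- n t / r) *\<^sub>R (- l t *\<^sub>R f1 t + n t *\<^sub>R \<mu> t) + d *\<^sub>R f2 t)
      = ((\<alpha> t * \<alpha> t - n t * n t) / r) *\<^sub>R \<mu> t
        + (c *\<^sub>R \<gamma> t + (n t * l t / r) *\<^sub>R f1 t + d *\<^sub>R f2 t)"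
      by (simp add: algebra_simps diff_divide_distrib)
    also have "\<dots> = lE t *\<^sub>R \<mu> t + nE t *\<^sub>R \<mu>E t"
      unfolding c d e f muE_eq r_def[symmetric] q_def[symmetric] scaleR_add_right scaleR_scaleR ..
    finally show ?thesis
      using D by simp
  qed

  have D_mu': "(\<mu> has_vector_derivative lE t *\<^sub>R \<eta> t) (at t within I)" if "t \<in> I" for t
  proof -
    have "sqrt (h t) \<noteq> 0"
      using h_pos[OF that] by simp
    \<comment> \<open>The root in \<open>lE\<close> cancels the normalisation of
      \<open>\<eta>\<close>.\<close>
    then have "lE t *\<^sub>R \<eta> t = - \<alpha> t *\<^sub>R \<gamma> t + n t *\<^sub>R f2 t"
      by (simp add: ellE eta_eq scaleR_diff_right flip: h_def)
    then show ?thesis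
      using D_mu[OF that] by simp
  qed

  have D_E: "(E has_vector_derivative \<alpha>E t *\<^sub>R \<mu>E t) (at t within I)" if "t \<in> I" for t
  proof -
    define r where "r = sqrt (h t)"
    define q where "q = sqrt (G t)"
    have r: "r \<noteq> 0" and q: "q \<noteq> 0" "G t \<noteq> 0"
      using h_pos[OF that] G_pos[OF that] by (simp_all add: r_def q_def)
    define N where "N = n t * (2 * l t * \<alpha>' t * n' t - n t * (- \<alpha>' t * l' t + l t * \<alpha>'' t))
      - \<alpha> t * ((l t)^3 * (n t)\<^sup>2 + n t * l' t * n' t + l t * (2 * (n' t)\<^sup>2 - n t * n'' t))"
    have \<alpha>E': "\<alpha>E t = r * (N / G t)"
      unfolding alphaE N_def r_def G_def h_def ..
    \<comment> \<open>\<open>c1\<close>, \<open>c2\<close>, \<open>c3\<close> are the derivatives of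
      the coefficients of \<open>E\<close>, again in the shape of \<open>DERIV_divide_sqrt\<close>;
      the derivatives of the frame vectors enter separately.\<close>
    define c1 where "c1 = ((l' t * n t * n t + 2 * l t * n t * n' t) * G t
      - l t * n t * n t * G' t / 2) / (G t * q)"
    define c2 where "c2 = (- (\<alpha> t * n'' t - n t * \<alpha>'' t) * G t - - W t * G' t / 2) / (G t * q)"
    define c3 where "c3 = (- (l' t * n t * \<alpha> t + l t * n' t * \<alpha> t + l t * n t * \<alpha>' t) * G t
      - - (l t * n t * \<alpha> t) * G' t / 2) / (G t * q)"
    have D1: "((\<lambda>t. l t * n t * n t) has_real_derivative l' t * n t * n t + 2 * l t * n t * n' t) (at t within I)"
      and D3: "((\<lambda>t. - (l t * n t * \<alpha> t)) has_real_derivative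
        - (l' t * n t * \<alpha> t + l t * n' t * \<alpha> t + l t * n t * \<alpha>' t)) (at t within I)"
      by (auto intro!: derivative_eq_intros D_curv that simp: algebra_simps)
    have D: "((\<lambda>t. (l t * n t * n t / sqrt (G t)) *\<^sub>R \<gamma> t + (- W t / sqrt (G t)) *\<^sub>R f1 t
        + (- (l t * n t * \<alpha> t) / sqrt (G t)) *\<^sub>R f2 t) has_vector_derivative
        ((l t * n t * n t / q) *\<^sub>R (\<alpha> t *\<^sub>R \<mu> t) + c1 *\<^sub>R \<gamma> t)
      + ((- W t / q) *\<^sub>R (l t *\<^sub>R f2 t) + c2 *\<^sub>R f1 t)
      + ((- (l t * n t * \<alpha> t) / q) *\<^sub>R (- l t *\<^sub>R f1 t + n t *\<^sub>R \<mu> t) + c3 *\<^sub>R f2 t)) (at t within I)"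
      unfolding c1_def c2_def c3_def q_def
      by (intro has_vector_derivative_add has_vector_derivative_scaleR DERIV_divide_sqrt DERIV_minus
          D1 D3 D_W D_G D_frame that G_pos)
    \<comment> \<open>Inner expressions are folded first: \<open>G_def\<close> is stated in terms of
      \<open>h\<close> and \<open>W\<close>, and \<open>G'_def\<close> uses these too.\<close>
    note polys = evolute_polynomial_identities[where a = "\<alpha> t" and ?a1.0 = "\<alpha>' t"
          and ?a2.0 = "\<alpha>'' t" and l = "l t" and ?l1.0 = "l' t" and n = "n t" and ?n1.0 = "n' t"
          and ?n2.0 = "n'' t",
        folded h_def W[THEN fun_cong], folded G_def, folded G'_def, folded N_def]
    have coeffs: "c1 = \<alpha>E t * (W t * n t / (r * q))"
      "c2 + l t * n t * \<alpha> t * l t / q = \<alpha>E t * (- (l t * n t * h t) / (r * q))"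
      "c3 - W t * l t / q = \<alpha>E t * (- (W t * \<alpha> t) / (r * q))"
    proof -
      \<comment> \<open>The derivatives of \<open>f1\<close> and \<open>f2\<close> contribute the
        extra summands. Over the common denominator the numerators become left-hand sides of the
        polynomial identities.\<close>
      have "c2 + l t * n t * \<alpha> t * l t / q
          = ((- (\<alpha> t * n'' t - n t * \<alpha>'' t) + l t * n t * \<alpha> t * l t) * G t + W t * G' t / 2) / (G t * q)"
        "c3 - W t * l t / q = ((- (l' t * n t * \<alpha> t + l t * n' t * \<alpha> t + l t * n t * \<alpha>' t) - W t * l t) * G t
          + l t * n t * \<alpha> t * G' t / 2) / (G t * q)"
        unfolding c2_def c3_def using q by (simp_all add: divide_simps) (simp_all add: algebra_simps)
      note eqs = this
      show "c1 = \<alpha>E t * (W t * n t / (r * q))"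
        "c2 + l t * n t * \<alpha> t * l t / q = \<alpha>E t * (- (l t * n t * h t) / (r * q))"
        "c3 - W t * l t / q = \<alpha>E t * (- (W t * \<alpha> t) / (r * q))"
        unfolding eqs c1_def \<alpha>E' polys using r q by simp_all
    qed
    \<comment> \<open>The two multiples of \<open>\<mu>\<close> cancel.\<close>
    have "((l t * n t * n t / q) *\<^sub>R (\<alpha> t *\<^sub>R \<mu> t) + c1 *\<^sub>R \<gamma> t)
        + ((- W t / q) *\<^sub>R (l t *\<^sub>R f2 t) + c2 *\<^sub>R f1 t)
        + ((- (l t * n t * \<alpha> t) / q) *\<^sub>R (- l t *\<^sub>R f1 t + n t *\<^sub>R \<mu> t) + c3 *\<^sub>R f2 t)
      = c1 *\<^sub>R \<gamma> t + (c2 + l t * n t * \<alpha> t * l t / q) *\<^sub>R f1 t + (c3 - W t * l t / q) *\<^sub>R f2 t"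
      by (simp add: algebra_simps)
    also have "\<dots> = \<alpha>E t *\<^sub>R \<mu>E t"
      unfolding coeffs muE_eq r_def[symmetric] q_def[symmetric] scaleR_add_right scaleR_scaleR ..
    \<comment> \<open>The closed form agrees with \<open>E\<close> on \<open>I\<close>, which is
      enough for a derivative within \<open>I\<close>.\<close>
    finally show ?thesis
      using has_vector_derivative_transform[OF that E_eq D] by simp
  qed

  \<comment> \<open>Smoothness and pseudo-orthonormality of the new frame\<close>
  have sqrt_nonzero: "sqrt (h t) \<noteq> 0" "sqrt (G t) \<noteq> 0" if "t \<in> I" for t
    using h_pos[OF that] G_pos[OF that] by simp_all
  have smooth_\<eta>: "ndiff_on k I \<eta>" for k
    unfolding eta_eq divide_inverse
    by (intro ndiff_on_intros smooth_curv smooth_h smooth_frame sqrt_nonzero h_pos)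
  have smooth_E: "ndiff_on k I E" for k
    by (subst ndiff_on_cong[OF E_eq], assumption, unfold divide_inverse)
      (intro ndiff_on_intros smooth_curv smooth_G smooth_W smooth_frame sqrt_nonzero G_pos)

  have pip_E: "pip (E t) (E t) = -1" "pip (E t) (\<mu> t) = 0" "pip (E t) (\<eta> t) = 0"
    "pip (\<eta> t) (\<eta> t) = 1" "pip (\<mu> t) (\<eta> t) = 0" if "t \<in> I" for t
  proof -
    interpret timelike_frame "\<gamma> t" "f1 t" "f2 t" by (rule frame[OF that])
    have G: "sqrt (G t) * sqrt (G t) = G t" "G t \<noteq> 0" and h: "sqrt (h t) * sqrt (h t) = h t" "h t \<noteq> 0"
      using G_pos[OF that] h_pos[OF that] by simp_all
    \<comment> \<open>The zero component along \<open>f1\<close> brings \<open>\<eta>\<close> into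
      the form of \<open>pip_combination\<close>.\<close>
    have \<eta>: "\<eta> t = (\<alpha> t / sqrt (h t)) *\<^sub>R \<gamma> t + 0 *\<^sub>R f1 t + (- n t / sqrt (h t)) *\<^sub>R f2 t"
      by (simp add: eta_eq)
    \<comment> \<open>Before normalisation the evolute has square \<open>- G\<close>, hence it is
      timelike.\<close>
    have "W t * W t + l t * n t * \<alpha> t * (l t * n t * \<alpha> t) - l t * n t * n t * (l t * n t * n t) = - G t"
      by (simp add: G_def h_def algebra_simps power2_eq_square)
    then show "pip (E t) (E t) = -1"
      unfolding E_eq[OF that] pip_combination times_divide_times_eq G(1)
      using G(2) by (simp flip: add_divide_distrib diff_divide_distrib)
    show "pip (E t) (\<mu> t) = 0" "pip (\<mu> t) (\<eta> t) = 0"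
      using pip_mu[OF that] pip_commute[of "E t" "\<mu> t"] unfolding E_eq[OF that] eta_eq
      by (simp_all add: pip.add_right pip.diff_right pip.scaleR_right)
    show "pip (E t) (\<eta> t) = 0"
      unfolding E_eq[OF that] \<eta> pip_combination by simp
    have "n t * n t - \<alpha> t * \<alpha> t = h t"
      by (simp add: h_def power2_eq_square)
    then show "pip (\<eta> t) (\<eta> t) = 1"
      unfolding \<eta> pip_combination times_divide_times_eq h(1)
      using h(2) by (simp flip: diff_divide_distrib)
  qed

  \<comment> \<open>The framed immersion and its curvature\<close>
  have "smooth_immersion_on I (\<lambda>t. (E t, \<mu> t, \<eta> t))"
    unfolding smooth_immersion_on_def smooth_curve_on_iff_ndiff
  proof (intro conjI allI ballI)
    show "ndiff_on k I (\<lambda>t. (E t, \<mu> t, \<eta> t))" for k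
      by (intro ndiff_on_Pair smooth_E smooth_\<mu> smooth_\<eta>)
    fix t assume t: "t \<in> I"
    have "deriv_on I (\<lambda>t. (E t, \<mu> t, \<eta> t)) t
        = (\<alpha>E t *\<^sub>R \<mu>E t, lE t *\<^sub>R \<eta> t, lE t *\<^sub>R \<mu> t + nE t *\<^sub>R \<mu>E t)"
      by (intro deriv_on_eqI has_vector_derivative_Pair D_E D_mu' D_eta t)
    \<comment> \<open>The velocity of \<open>\<mu>\<close>, a nonzero multiple of the unit vector
      \<open>\<eta>\<close>, already makes the framed curve regular, so zeros of
      \<open>\<alpha>E\<close> do no harm.\<close>
    moreover have "lE t \<noteq> 0"
      using h_pos[OF t] by (simp add: ellE h_def)
    moreover have "\<eta> t \<noteq> 0"
      using pip_E(4)[OF t] by (auto simp: pip.zero_left)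
    ultimately show "deriv_on I (\<lambda>t. (E t, \<mu> t, \<eta> t)) t \<noteq> 0"
      by (simp add: prod_eq_iff)
  qed
  moreover have deriv_E: "deriv_on I E t = \<alpha>E t *\<^sub>R \<mu>E t" if "t \<in> I" for t
    by (rule deriv_on_eqI[OF D_E[OF that] that])
  \<comment> \<open>The pair of \<open>\<mu>\<close> and \<open>\<eta>\<close> lies in
    \<open>Delta1\<close> with its timelike vector first. \<open>E'\<close> is orthogonal to both,
    being a multiple of their triple product with \<open>E\<close>.\<close>
  ultimately have spacelike: "spacelike_framed_immersion I E \<mu> \<eta>"
    using pip_E pip_mu(1)
    by (auto simp: spacelike_framed_immersion_def framed_immersion_def Delta1_def AdS3_def S32_def
        muE_triple pip.scaleR_left pip_triple_self)
  moreover have "spacelike_curvature I E \<mu> \<eta> \<alpha>E lE (\<lambda>t. 0) nE"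
    using deriv_E deriv_on_eqI[OF D_mu'] deriv_on_eqI[OF D_eta]
    by (simp add: spacelike_curvature_def Let_def flip: muE_triple)
  ultimately show ?thesis
    using muE_triple unfolding spacelike_framed_base_curve_def by blast
qed

end
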